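(* For $a\in(0,1/3)$ let $D_a$ be the spectral order of the function $\tilde P_a$. Then $D_a\nearrow2$ as $a\nearrow1/3$, i.e. $D_a$ tends to $2$ from below as $a$ tends to $1/3$ from below.
   Context: Self-similar functions. Let $n>1$ be a natural number and let $a_k>0$, $d_k$, $\beta_k$ ($k=1,\dots,n$) be real numbers with $\sum_{k=1}^n a_k=1$. Put $\alpha_1=0$, $\alpha_k=\sum_{l=1}^{k-1}a_l$ for $k=2,\dots,n+1$. The similarity operator $G:L_2[0,1]\to L_2[0,1]$ is $$G(f)=\sum_{k=1}^n\{\beta_k\,\chi_{(\alpha_k,\alpha_{k+1})}+d_k\,G_k(f)\},$$ where $\chi_\Gamma$ is the characteristic function of the interval $\Gamma$ and $G_k$ is the continuous linear operator on $L_2[0,1]$ determined by $G_k(\chi_{(\zeta,\xi)})=\chi_{(\alpha_k+a_k\zeta,\,\alpha_k+a_k\xi)}$ for all $(\zeta,\xi)\subset[0,1]$; that is, $(G_kf)(x)=f((x-\alpha_k)/a_k)$ for $x\in(\alpha_k,\alpha_{k+1})$ and $(G_kf)(x)=0$ otherwise. It is always assumed that $\sum_{k=1}^n a_k|d_k|^2<1$; then $G$ has a unique fixed point $f\in L_2[0,1]$, $G(f)=f$, called the self-similar function with self-similarity parameters $n,a_k,d_k,\beta_k$. If at least two of the $d_k$ and at least one of the $\beta_k$ are nonzero, the spectral order of this self-similar function is the unique positive solution $D$ of $\sum_{k=1}^n(a_k|d_k|)^{D/2}=1$ (with $0^{D/2}=0$). For $a\in(0,1/2)$ and $\delta\in[0,1/2)$,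 $P_{a,\delta}\in L_2[0,1]$ is the self-similar function with parameters $n=3$, $a_1=a_3=a$, $a_2=1-2a$, $d_1=d_3=1/2+\delta$, $d_2=-2\delta$, $\beta_1=0$, $\beta_2=1/2+\delta$, $\beta_3=1/2-\delta$. For $a\in(0,1/3)$, $\tilde P_a$ denotes the function $P_{a,\delta}$ with $\delta$ determined by $(2-5a)\,\delta=a/2$. The spectral order $D_a$ is computed from these parameters. *)

theory Defs
  imports "HOL-Analysis.Analysis"
begin

(* The families are indexed from 1; only their values at 1, ..., num_pieces matter. *)
record self_sim_params =
  num_pieces :: nat
  coef_a :: "nat \<Rightarrow> real"
  coef_d :: "nat \<Rightarrow> real"
  coef_beta :: "nat \<Rightarrow> real"

definition admissible :: "self_sim_params \<Rightarrow> bool" where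
  "admissible p \<longleftrightarrow>
     num_pieces p > 1 \<and>
     (\<forall>k\<in>{1..num_pieces p}. coef_a p k > 0) \<and>
     (\<Sum>k=1..num_pieces p. coef_a p k) = 1 \<and>
     (\<Sum>k=1..num_pieces p. coef_a p k * \<bar>coef_d p k\<bar>\<^sup>2) < 1"

definition breakpoint :: "self_sim_params \<Rightarrow> nat \<Rightarrow> real" where
  "breakpoint p k = (\<Sum>l=1..<k. coef_a p l)"

definition piece :: "self_sim_params \<Rightarrow> nat \<Rightarrow> real set" where
  "piece p k = {breakpoint p k <..< breakpoint p (k + 1)}"

definition piece_operator :: "self_sim_params \<Rightarrow> nat \<Rightarrow> (real \<Rightarrow> real) \<Rightarrow> real \<Rightarrow> real" where
  "piece_operator p k f x =
     (if x \<in> piece p k then f ((x - breakpoint p k) / coef_a p k) else 0)"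

definition similarity_operator :: "self_sim_params \<Rightarrow> (real \<Rightarrow> real) \<Rightarrow> real \<Rightarrow> real" where
  "similarity_operator p f x =
     (\<Sum>k=1..num_pieces p. coef_beta p k * indicator (piece p k) x
                           + coef_d p k * piece_operator p k f x)"

(* Elements of L_2[0,1] are represented by functions, and equality in L_2[0,1] is
   equality almost everywhere on [0,1]. *)
definition in_L2_01 :: "(real \<Rightarrow> real) \<Rightarrow> bool" where
  "in_L2_01 f \<longleftrightarrow>
     f \<in> borel_measurable (lebesgue_on {0..1}) \<and>
     integrable (lebesgue_on {0..1}) (\<lambda>x. (f x)\<^sup>2)"

definition is_self_similar_function :: "self_sim_params \<Rightarrow> (real \<Rightarrow> real) \<Rightarrow> bool" where
  "is_self_similar_function p f \<longleftrightarrow>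
     admissible p \<and> in_L2_01 f \<and>
     (AE x in lebesgue_on {0..1}. similarity_operator p f x = f x)"

(* SOME picks a representative: the fixed point is unique only almost everywhere. *)
definition self_similar_function :: "self_sim_params \<Rightarrow> real \<Rightarrow> real" where
  "self_similar_function p = (SOME f. is_self_similar_function p f)"

(* D is computed from the parameters p that present f as a self-similar function.
   In HOL 0 powr s = 0, which is the required convention. *)
definition is_spectral_order :: "self_sim_params \<Rightarrow> (real \<Rightarrow> real) \<Rightarrow> real \<Rightarrow> bool" where
  "is_spectral_order p f D \<longleftrightarrow>
     is_self_similar_function p f \<and>
     card {k\<in>{1..num_pieces p}. coef_d p k \<noteq> 0} \<ge> 2 \<and>
     (\<exists>k\<in>{1..num_pieces p}. coef_beta p k \<noteq> 0) \<and>
     D > 0 \<and>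
     (\<Sum>k=1..num_pieces p. (coef_a p k * \<bar>coef_d p k\<bar>) powr (D / 2)) = 1"

definition spectral_order :: "self_sim_params \<Rightarrow> (real \<Rightarrow> real) \<Rightarrow> real" where
  "spectral_order p f = (THE D. is_spectral_order p f D)"

definition P_params :: "real \<Rightarrow> real \<Rightarrow> self_sim_params" where
  "P_params a \<delta> =
     \<lparr> num_pieces = 3,
       coef_a = (\<lambda>_. 0)(1 := a, 2 := 1 - 2 * a, 3 := a),
       coef_d = (\<lambda>_. 0)(1 := 1/2 + \<delta>, 2 := - 2 * \<delta>, 3 := 1/2 + \<delta>),
       coef_beta = (\<lambda>_. 0)(1 := 0, 2 := 1/2 + \<delta>, 3 := 1/2 - \<delta>) \<rparr>"

definition P_fun :: "real \<Rightarrow> real \<Rightarrow> real \<Rightarrow> real" where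
  "P_fun a \<delta> = self_similar_function (P_params a \<delta>)"

definition tilde_delta :: "real \<Rightarrow> real" where
  "tilde_delta a = (THE \<delta>. (2 - 5 * a) * \<delta> = a / 2)"

definition Ptilde :: "real \<Rightarrow> real \<Rightarrow> real" where
  "Ptilde a = P_fun a (tilde_delta a)"

definition D_order :: "real \<Rightarrow> real" where
  "D_order a = spectral_order (P_params a (tilde_delta a)) (Ptilde a)"

end

theory Submission
  imports Defs
begin

text \<open>
  For \<open>0 < a < 1/3\<close> the equation \<open>(2 - 5 * a) * \<delta> = a / 2\<close> gives \<open>0 < \<delta> < 1/2\<close>, so all three
  numbers \<open>\<bar>coef_d k\<bar>\<close> lie in \<open>(0, 1)\<close>.  Hence the similarity operator contracts the supremum
  norm, and its iterates on \<open>0\<close> converge pointwise to a bounded Borel fixed point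
  (\<open>ex_self_similar_function\<close>); the \<open>L\<^sub>2\<close> contraction argument is not needed.

  Put \<open>c k = coef_a k * \<bar>coef_d k\<bar>\<close>, which lies in \<open>(0, 1)\<close> as well, and
  \<open>\<phi> a s = (\<Sum>k. c k powr s)\<close>.  This is continuous and strictly decreasing in \<open>s\<close>, with
  \<open>\<phi> a 0 = 3\<close> and \<open>\<phi> a 1 = a * (3 - 6 * a) / (2 - 5 * a)\<close>; the last value is below \<open>1\<close> because
  \<open>2 - 8 * a + 6 * a\<^sup>2 = 2 * (1 - a) * (1 - 3 * a) > 0\<close>.  So the equation \<open>\<phi> a s = 1\<close> has a unique
  solution \<open>s = D_order a / 2\<close>, and it lies in \<open>(0, 1)\<close> (\<open>D_order_properties\<close>).
  As \<open>a\<close> tends to \<open>1/3\<close>, each \<open>c k\<close> tends to \<open>1/3\<close>, so \<open>\<phi> a s\<close> tends to \<open>3 powr (1 - s)\<close>, which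
  exceeds \<open>1\<close> whenever \<open>s < 1\<close>.  By monotonicity the solution eventually exceeds every \<open>s < 1\<close>.
\<close>

section \<open>Bounded fixed points of the similarity operator\<close>

lemma breakpoint_mono:
  assumes "admissible p" "i \<le> j" "j \<le> num_pieces p + 1"
  shows "breakpoint p i \<le> breakpoint p j"
  unfolding breakpoint_def
proof (rule sum_mono2)
  show "0 \<le> coef_a p l" if "l \<in> {1..<j} - {1..<i}" for l
    using assms that by (auto simp: admissible_def intro!: less_imp_le)
qed (use assms in auto)

lemma piece_unique:
  assumes "admissible p" "i \<in> {1..num_pieces p}" "j \<in> {1..num_pieces p}"
    and "x \<in> piece p i" "x \<in> piece p j"
  shows "i = j"
proof -
  have False if "k < l" "l \<le> num_pieces p" "x \<in> piece p k" "x \<in> piece p l" for k l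
    using breakpoint_mono[OF assms(1), of "k + 1" l] that by (auto simp: piece_def)
  then show ?thesis
    using assms by (meson atLeastAtMost_iff linorder_neqE_nat)
qed

lemma similarity_operator_on_piece:
  assumes "admissible p" "k \<in> {1..num_pieces p}" "x \<in> piece p k"
  shows "similarity_operator p f x
           = coef_beta p k + coef_d p k * f ((x - breakpoint p k) / coef_a p k)"
proof -
  have "similarity_operator p f x
      = (\<Sum>j=1..num_pieces p. if j = k
           then coef_beta p k + coef_d p k * f ((x - breakpoint p k) / coef_a p k) else 0)"
    unfolding similarity_operator_def
  proof (rule sum.cong)
    fix j assume "j \<in> {1..num_pieces p}"
    then have "x \<in> piece p j \<longleftrightarrow> j = k"
      using piece_unique assms by blast
    then show "coef_beta p j * indicator (piece p j) x + coef_d p j * piece_operator p j f x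
      = (if j = k then coef_beta p k + coef_d p k * f ((x - breakpoint p k) / coef_a p k) else 0)"
      by (auto simp: piece_operator_def)
  qed simp
  then show ?thesis
    using assms(2) by simp
qed

lemma similarity_operator_off_pieces:
  assumes "\<forall>k\<in>{1..num_pieces p}. x \<notin> piece p k"
  shows "similarity_operator p f x = 0"
  using assms by (auto simp: similarity_operator_def piece_operator_def intro!: sum.neutral)

lemma borel_measurable_similarity_operator:
  assumes [measurable]: "f \<in> borel_measurable borel"
  shows "similarity_operator p f \<in> borel_measurable borel"
proof -
  have [measurable]: "piece p k \<in> sets borel" for k
    by (simp add: piece_def)
  show ?thesis
    unfolding similarity_operator_def[abs_def] piece_operator_def by measurable
qed

text \<open>
  The bound \<open>\<bar>coef_d p k\<bar> \<le> q < 1\<close> is stronger than the inequality in \<open>admissible\<close>; it yields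
  a fixed point at every point of the line and not only almost everywhere.
\<close>

lemma ex_self_similar_function:
  assumes adm: "admissible p"
    and d_le: "\<And>k. k \<in> {1..num_pieces p} \<Longrightarrow> \<bar>coef_d p k\<bar> \<le> q"
    and q: "0 \<le> q" "q < 1"
  shows "\<exists>f. is_self_similar_function p f"
proof -
  define g where "g n = (similarity_operator p ^^ n) (\<lambda>_. 0)" for n
  define B where "B = (\<Sum>k=1..num_pieces p. \<bar>coef_beta p k\<bar>)"
  have g0: "g 0 x = 0" for x
    by (simp add: g_def)
  have gS: "g (Suc n) = similarity_operator p (g n)" for n
    by (simp add: g_def)
  have B0: "0 \<le> B"
    by (simp add: B_def sum_nonneg)
  have beta_le: "\<bar>coef_beta p k\<bar> \<le> B" if "k \<in> {1..num_pieces p}" for k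
    unfolding B_def by (rule member_le_sum) (use that in auto)
  have piece_cases:
    "(\<exists>k\<in>{1..num_pieces p}. x \<in> piece p k) \<or> (\<forall>k\<in>{1..num_pieces p}. x \<notin> piece p k)" for x
    by blast
  have scale: "\<bar>coef_d p k * y\<bar> \<le> q * C" if "k \<in> {1..num_pieces p}" "\<bar>y\<bar> \<le> C" for k y C
    unfolding abs_mult using d_le[OF that(1)] that(2) q by (intro mult_mono) auto
  \<comment> \<open>On a piece the constant term cancels in a difference, so one application of the operator
    multiplies the bound by \<open>q\<close>.\<close>
  have step: "\<bar>g (Suc n) x - g n x\<bar> \<le> B * q ^ n" for n x
  proof (induction n arbitrary: x)
    case 0
    consider k where "k \<in> {1..num_pieces p}" "x \<in> piece p k"
      | "\<forall>k\<in>{1..num_pieces p}. x \<notin> piece p k"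
      using piece_cases[of x] by blast
    then show ?case
    proof cases
      case (1 k)
      show ?thesis
        using beta_le[OF 1(1)] by (simp add: gS g0 similarity_operator_on_piece[OF adm 1])
    next
      case 2
      then show ?thesis
        using B0 by (simp add: gS g0 similarity_operator_off_pieces)
    qed
  next
    case (Suc n)
    consider k where "k \<in> {1..num_pieces p}" "x \<in> piece p k"
      | "\<forall>k\<in>{1..num_pieces p}. x \<notin> piece p k"
      using piece_cases[of x] by blast
    then show ?case
    proof cases
      case (1 k)
      define y where "y = (x - breakpoint p k) / coef_a p k"
      have "g (Suc (Suc n)) x - g (Suc n) x = coef_d p k * (g (Suc n) y - g n y)"
        unfolding gS[of "Suc n"] gS[of n] similarity_operator_on_piece[OF adm 1]
        by (simp add: y_def algebra_simps)
      then show ?thesis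
        using scale[OF 1(1) Suc.IH[of y]] by (simp add: algebra_simps)
    next
      case 2
      then show ?thesis
        using B0 q by (simp add: gS similarity_operator_off_pieces)
    qed
  qed
  \<comment> \<open>The bound \<open>B / (1 - q)\<close> is the fixed point of \<open>\<lambda>C. B + q * C\<close>.\<close>
  have bound: "\<bar>g n x\<bar> \<le> B / (1 - q)" for n x
  proof (induction n arbitrary: x)
    case 0
    show ?case
      using B0 q by (simp add: g0)
  next
    case (Suc n)
    consider k where "k \<in> {1..num_pieces p}" "x \<in> piece p k"
      | "\<forall>k\<in>{1..num_pieces p}. x \<notin> piece p k"
      using piece_cases[of x] by blast
    then show ?case
    proof cases
      case (1 k)
      have "\<bar>g (Suc n) x\<bar> \<le> B + q * (B / (1 - q))"
        unfolding gS similarity_operator_on_piece[OF adm 1]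
        by (rule order_trans[OF abs_triangle_ineq])
           (intro add_mono beta_le[OF 1(1)] scale[OF 1(1)] Suc.IH)
      also have "\<dots> = B / (1 - q)"
        using q by (simp add: field_simps)
      finally show ?thesis .
    next
      case 2
      then show ?thesis
        using B0 q by (simp add: gS similarity_operator_off_pieces)
    qed
  qed
  have "convergent (\<lambda>n. g n x)" for x
  proof -
    have "summable (\<lambda>n. B * q ^ n)"
      using q by (intro summable_mult summable_geometric) simp
    then have "summable (\<lambda>n. g (Suc n) x - g n x)"
      by (rule summable_comparison_test') (use step in simp)
    then have "convergent (\<lambda>m. \<Sum>n<m. g (Suc n) x - g n x)"
      by (simp add: summable_iff_convergent)
    then show ?thesis
      by (simp add: sum_lessThan_telescope[of "\<lambda>n. g n x"] g0)
  qed
  then obtain f where f: "\<And>x. (\<lambda>n. g n x) \<longlonglongrightarrow> f x"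
    unfolding convergent_def by metis
  have fixp: "similarity_operator p f x = f x" for x
  proof -
    have "(\<lambda>n. similarity_operator p (g n) x) \<longlonglongrightarrow> similarity_operator p f x"
      unfolding similarity_operator_def piece_operator_def
      by (intro tendsto_intros) (auto intro: f)
    moreover have "(\<lambda>n. g (Suc n) x) \<longlonglongrightarrow> f x"
      using f by (rule LIMSEQ_Suc)
    ultimately show ?thesis
      unfolding gS by (rule LIMSEQ_unique)
  qed
  have "g n \<in> borel_measurable borel" for n
    by (induction n) (auto simp: gS g0[abs_def] borel_measurable_similarity_operator
        intro: measurable_cong[THEN iffD2, OF g0])
  then have "f \<in> borel_measurable borel"
    by (rule borel_measurable_LIMSEQ_real[OF f])
  then have f_meas [measurable]: "f \<in> borel_measurable (lebesgue_on {0..1})"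
    by (intro measurable_restrict_space1 measurable_completion) simp
  have f_bound: "\<bar>f x\<bar> \<le> B / (1 - q)" for x
    using tendsto_rabs[OF f] by (rule LIMSEQ_le_const2) (use bound in auto)
  have "finite_measure (lebesgue_on {0..1::real})"
    by (rule finite_measure_lebesgue_on) simp
  then have "integrable (lebesgue_on {0..1}) (\<lambda>x. (f x)\<^sup>2)"
  proof (rule finite_measure.integrable_const_bound[where B = "(B / (1 - q))\<^sup>2"])
    have "norm ((f x)\<^sup>2) \<le> (B / (1 - q))\<^sup>2" for x
      using power_mono[OF f_bound[of x], of 2] by simp
    then show "AE x in lebesgue_on {0..1}. norm ((f x)\<^sup>2) \<le> (B / (1 - q))\<^sup>2"
      by simp
  qed measurable
  then have "is_self_similar_function p f"
    using adm f_meas by (simp add: is_self_similar_function_def in_L2_01_def fixp)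
  then show ?thesis
    by blast
qed

section \<open>Sums of real powers as functions of the exponent\<close>

lemma sum_powr_strict_antimono:
  fixes c :: "'a \<Rightarrow> real"
  assumes "finite A" "A \<noteq> {}" "\<And>k. k \<in> A \<Longrightarrow> 0 < c k \<and> c k < 1" "s < t"
  shows "(\<Sum>k\<in>A. c k powr t) < (\<Sum>k\<in>A. c k powr s)"
  using assms by (intro sum_strict_mono powr_less_mono') auto

lemma ex_sum_powr_eq_1:
  fixes c :: "'a \<Rightarrow> real"
  assumes "card A \<ge> 2" "\<And>k. k \<in> A \<Longrightarrow> 0 < c k" "(\<Sum>k\<in>A. c k) < 1"
  shows "\<exists>s. 0 < s \<and> s < 1 \<and> (\<Sum>k\<in>A. c k powr s) = 1"
proof -
  have at_0: "(\<Sum>k\<in>A. c k powr 0) = card A"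
    using assms(2) by (simp add: less_imp_neq[symmetric])
  have "(\<Sum>k\<in>A. c k powr 1) = (\<Sum>k\<in>A. c k)"
    using assms(2) by (intro sum.cong) (auto simp: less_imp_le)
  then have at_1: "(\<Sum>k\<in>A. c k powr 1) < 1"
    using assms(3) by simp
  have "continuous_on {0..1} (\<lambda>s. \<Sum>k\<in>A. c k powr s)"
    using assms(2) by (intro continuous_intros) (auto simp: less_imp_neq[symmetric])
  then obtain s where s: "0 \<le> s" "s \<le> 1" "(\<Sum>k\<in>A. c k powr s) = 1"
    using IVT2'[of "\<lambda>s. \<Sum>k\<in>A. c k powr s" 1 1 0] at_0 at_1 assms(1) by fastforce
  moreover have "s \<noteq> 0" "s \<noteq> 1"
    using s(3) at_0 at_1 assms(1) by auto
  ultimately show ?thesis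
    by (intro exI[of _ s]) auto
qed

section \<open>The spectral order\<close>

lemma tilde_delta_eq:
  assumes "a < 1/3"
  shows "tilde_delta a = a / (2 * (2 - 5 * a))"
  unfolding tilde_delta_def by (rule the_equality) (use assms in \<open>auto simp: field_simps\<close>)

lemma tilde_delta_bounds:
  assumes "0 < a" "a < 1/3"
  shows "0 < tilde_delta a" "tilde_delta a < 1/2"
  using assms by (auto simp: tilde_delta_eq field_simps)

lemma P_params_simps [simp]:
  "num_pieces (P_params a \<delta>) = 3"
  "coef_a (P_params a \<delta>) (Suc 0) = a" "coef_a (P_params a \<delta>) 2 = 1 - 2 * a"
  "coef_a (P_params a \<delta>) 3 = a"
  "coef_d (P_params a \<delta>) (Suc 0) = 1/2 + \<delta>" "coef_d (P_params a \<delta>) 2 = - 2 * \<delta>"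
  "coef_d (P_params a \<delta>) 3 = 1/2 + \<delta>"
  "coef_beta (P_params a \<delta>) 2 = 1/2 + \<delta>"
  by (simp_all add: P_params_def)

lemma atLeastAtMost_1_3: "{Suc 0..3} = {Suc 0, 2, 3}"
  by auto

lemma admissible_P_params:
  assumes "0 < a" "a < 1/2" "0 \<le> \<delta>" "\<delta> < 1/2"
  shows "admissible (P_params a \<delta>)"
proof -
  have "(1/2 + \<delta>)\<^sup>2 < 1" "(2 * \<delta>)\<^sup>2 < 1"
    unfolding abs_square_less_1 using assms by auto
  then have "0 < 2 * (a * (1 - (1/2 + \<delta>)\<^sup>2)) + (1 - 2 * a) * (1 - (2 * \<delta>)\<^sup>2)"
    using assms(1,2) by (intro add_pos_pos mult_pos_pos) simp_all
  also have "\<dots> = 1 - (2 * (a * (1/2 + \<delta>)\<^sup>2) + (1 - 2 * a) * (2 * \<delta>)\<^sup>2)"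
    by algebra
  finally have "2 * (a * (1/2 + \<delta>)\<^sup>2) + (1 - 2 * a) * (2 * \<delta>)\<^sup>2 < 1"
    by (simp only: diff_gt_0_iff_gt)
  then show ?thesis
    using assms by (simp add: admissible_def atLeastAtMost_1_3)
qed

text \<open>
  The bases \<open>c k\<close> of the powers in the equation for the spectral order of \<open>Ptilde a\<close>.  They depend
  only on the parameters, and the parameters are continuous at \<open>a = 1/3\<close>, where \<open>\<delta> = 1/2\<close>.
\<close>

definition base :: "real \<Rightarrow> nat \<Rightarrow> real" where
  "base a k = coef_a (P_params a (tilde_delta a)) k * \<bar>coef_d (P_params a (tilde_delta a)) k\<bar>"

lemma base_bounds:
  assumes "0 < a" "a < 1/3" "k \<in> {1..3}"
  shows "0 < base a k \<and> base a k < 1"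
proof -
  note \<delta> = tilde_delta_bounds[OF assms(1,2)]
  have "a * (1/2 + tilde_delta a) < 1 * 1" "(1 - 2 * a) * (2 * tilde_delta a) < 1 * 1"
    using assms \<delta> by (intro mult_strict_mono; simp)+
  then show ?thesis
    using assms \<delta> by (auto simp: base_def atLeastAtMost_1_3)
qed

lemma sum_base_less_1:
  assumes "0 < a" "a < 1/3"
  shows "(\<Sum>k=1..3. base a k) < 1"
proof -
  have "(\<Sum>k=1..3. base a k) = a * (3 - 6 * a) / (2 - 5 * a)"
    using assms tilde_delta_bounds[OF assms]
    by (simp add: base_def atLeastAtMost_1_3 abs_mult tilde_delta_eq divide_simps)
       (simp add: algebra_simps)
  moreover have "0 < 2 * (1 - a) * (1 - 3 * a)"
    using assms by (intro mult_pos_pos) auto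
  then have "a * (3 - 6 * a) < 2 - 5 * a"
    by (simp add: algebra_simps)
  then have "a * (3 - 6 * a) / (2 - 5 * a) < 1"
    using assms by (simp add: divide_less_eq_1_pos)
  ultimately show ?thesis
    by simp
qed

lemma is_self_similar_Ptilde:
  assumes "0 < a" "a < 1/3"
  shows "is_self_similar_function (P_params a (tilde_delta a)) (Ptilde a)"
proof -
  note \<delta> = tilde_delta_bounds[OF assms]
  have "\<exists>f. is_self_similar_function (P_params a (tilde_delta a)) f"
  proof (rule ex_self_similar_function)
    show "admissible (P_params a (tilde_delta a))"
      using assms \<delta> by (intro admissible_P_params) auto
    show "\<bar>coef_d (P_params a (tilde_delta a)) k\<bar> \<le> 1/2 + tilde_delta a"
      if "k \<in> {1..num_pieces (P_params a (tilde_delta a))}" for k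
      using that \<delta> by (auto simp: atLeastAtMost_1_3)
  qed (use \<delta> in auto)
  then show ?thesis
    unfolding Ptilde_def P_fun_def self_similar_function_def by (rule someI_ex)
qed

lemma D_order_properties:
  assumes "0 < a" "a < 1/3"
  shows "D_order a < 2" "(\<Sum>k=1..3. base a k powr (D_order a / 2)) = 1"
proof -
  note \<delta> = tilde_delta_bounds[OF assms]
  have nonzero: "{k\<in>{1..3::nat}. coef_d (P_params a (tilde_delta a)) k \<noteq> 0} = {1, 2, 3}"
    using \<delta> by (auto simp: atLeastAtMost_1_3)
  have order_iff: "is_spectral_order (P_params a (tilde_delta a)) (Ptilde a) D
      \<longleftrightarrow> 0 < D \<and> (\<Sum>k=1..3. base a k powr (D / 2)) = 1" for D
  proof -
    have "\<exists>k\<in>{1..3}. coef_beta (P_params a (tilde_delta a)) k \<noteq> 0"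
      using \<delta> by (intro bexI[of _ 2]) auto
    moreover have "2 \<le> card {k\<in>{1..3::nat}. coef_d (P_params a (tilde_delta a)) k \<noteq> 0}"
      unfolding nonzero by simp
    ultimately show ?thesis
      using is_self_similar_Ptilde[OF assms]
      by (simp add: is_spectral_order_def base_def)
  qed
  obtain s where s: "0 < s" "s < 1" "(\<Sum>k=1..3. base a k powr s) = 1"
    using ex_sum_powr_eq_1[of "{1..3}" "base a"] base_bounds[OF assms] sum_base_less_1[OF assms]
    by auto
  have "D_order a = 2 * s"
    unfolding D_order_def spectral_order_def
  proof (rule the_equality)
    show "is_spectral_order (P_params a (tilde_delta a)) (Ptilde a) (2 * s)"
      using s by (simp add: order_iff)
    show "D = 2 * s" if "is_spectral_order (P_params a (tilde_delta a)) (Ptilde a) D" for D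
    proof -
      have "(\<Sum>k=1..3. base a k powr (D / 2)) = (\<Sum>k=1..3. base a k powr s)"
        using that s by (simp add: order_iff)
      then have "\<not> D / 2 < s" "\<not> s < D / 2"
        using sum_powr_strict_antimono[of "{1..3}" "base a"] base_bounds[OF assms]
        by (metis atLeastAtMost_iff empty_iff finite_atLeastAtMost less_irrefl one_le_numeral order_refl)+
      then show ?thesis
        by simp
    qed
  qed
  then show "D_order a < 2" "(\<Sum>k=1..3. base a k powr (D_order a / 2)) = 1"
    using s by simp_all
qed

lemma tendsto_base:
  assumes "k \<in> {1..3}"
  shows "((\<lambda>a. base a k) \<longlongrightarrow> 1/3) (at_left (1/3))"
proof -
  have "((\<lambda>a::real. a / (2 * (2 - 5 * a))) \<longlongrightarrow> (1/3) / (2 * (2 - 5 * (1/3)))) (at_left (1/3))"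
    by (intro tendsto_intros) auto
  moreover have "\<forall>\<^sub>F a in at_left (1/3). a / (2 * (2 - 5 * a)) = tilde_delta a"
    by (rule eventually_at_leftI[of 0]) (auto simp: tilde_delta_eq)
  ultimately have \<delta>: "(tilde_delta \<longlongrightarrow> 1/2) (at_left (1/3))"
    by (simp add: tendsto_cong)
  have "((\<lambda>a. a * \<bar>1/2 + tilde_delta a\<bar>) \<longlongrightarrow> 1/3 * \<bar>1/2 + 1/2\<bar>) (at_left (1/3))"
    "((\<lambda>a. (1 - 2 * a) * \<bar>- 2 * tilde_delta a\<bar>) \<longlongrightarrow> (1 - 2 * (1/3)) * \<bar>- 2 * (1/2)\<bar>) (at_left (1/3))"
    by (intro tendsto_intros \<delta>)+
  then show ?thesis
    using assms by (auto simp: base_def atLeastAtMost_1_3)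
qed

theorem mainTheorem5:
  shows "filterlim D_order (at_left 2) (at_left (1/3))"
proof -
  have near: "\<forall>\<^sub>F a in at_left (1/3). 0 < a \<and> a < (1/3::real)"
    by (rule eventually_at_leftI[of 0]) auto
  have below: "\<forall>\<^sub>F a in at_left (1/3). D_order a < 2"
    using near by eventually_elim (simp add: D_order_properties)
  have "(D_order \<longlongrightarrow> 2) (at_left (1/3))"
  proof (rule order_tendstoI)
    fix l :: real assume "l < 2"
    have "((\<lambda>a. \<Sum>k=1..3. base a k powr (l / 2)) \<longlongrightarrow> (\<Sum>k=1..3::nat. (1/3) powr (l / 2)))
            (at_left (1/3))"
      by (intro tendsto_sum tendsto_powr tendsto_base tendsto_const) auto
    moreover have "(1::real) < (\<Sum>k=1..3::nat. (1/3) powr (l / 2))"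
    proof -
      have "(1/3::real) powr 1 < (1/3) powr (l / 2)"
        using \<open>l < 2\<close> by (intro powr_less_mono') auto
      then show ?thesis
        by simp
    qed
    ultimately have "\<forall>\<^sub>F a in at_left (1/3). 1 < (\<Sum>k=1..3. base a k powr (l / 2))"
      by (rule order_tendstoD)
    with near show "\<forall>\<^sub>F a in at_left (1/3). l < D_order a"
    proof eventually_elim
      case (elim a)
      show ?case
      proof (rule ccontr)
        assume "\<not> l < D_order a"
        then have "D_order a / 2 = l / 2 \<or> D_order a / 2 < l / 2"
          by auto
        then have "(\<Sum>k=1..3. base a k powr (l / 2)) \<le> (\<Sum>k=1..3. base a k powr (D_order a / 2))"
          using sum_powr_strict_antimono[of "{1..3}" "base a" "D_order a / 2" "l / 2"] base_bounds elim
          by fastforce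
        then show False
          using D_order_properties(2)[of a] elim by simp
      qed
    qed
  next
    fix u :: real assume "2 < u"
    then show "\<forall>\<^sub>F a in at_left (1/3). D_order a < u"
      using below by (auto elim: eventually_mono)
  qed
  moreover have "\<forall>\<^sub>F a in at_left (1/3). D_order a \<in> {..<2} \<and> D_order a \<noteq> 2"
    using below by eventually_elim simp
  ultimately show ?thesis
    by (simp add: filterlim_at)
qed

end
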